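(* Let $1\le k\le n$. Then: (i) if $n=k$, $F_{n,k}(12/3)=(rs)^{\binom{k}{2}}$; (ii) if $n>k$, $$F_{n,k}(12/3)=\sum_{i=1}^{k}q^{(n-k)(k-i)}\,r^{\binom{k}{2}+(n-k)(i-1)}\,s^{\binom{k}{2}}\,t^{k-i}.$$
   Context: A set partition $\pi=B_1/B_2/\cdots/B_k$ of $[n]=\{1,\dots,n\}$ is written with its blocks ordered so that $\min B_1<\min B_2<\cdots<\min B_k$. For $S\subseteq[n]$, restrict $\pi$ to $S$ by taking the nonempty intersections $B_i\cap S$, and standardize by replacing the smallest element of $S$ by $1$, the second smallest by $2$, etc. The partition $\pi$ contains a partition $\omega$ if the standardized restriction to some $S$ equals $\omega$; otherwise $\pi$ avoids $\omega$. $\Pi_{n,k}(\omega)$ is the set of partitions of $[n]$ with exactly $k$ blocks that avoid $\omega$. Here $12/3$ denotes the partition $\{\{1,2\},\{3\}\}$ of $[3]$. The restricted growth function (RGF) of $\pi$ is the word $w(\pi)=a_1\cdots a_n$ with $a_i=j$ iff $i\in B_j$. For a word $w=a_1\cdots a_n$ put $lb(a_j)=\#\{a_i: i<j,\ a_i>a_j\}$, $ls(a_j)=\#\{a_i: i<j,\ a_i<a_j\}$, $rb(a_j)=\#\{a_i: i>j,\ a_i>a_j\}$, $rs(a_j)=\#\{a_i: i>j,\ a_i<a_j\}$, where each is the cardinality of a set of values (distinct letters are counted once), and let $lb(w)=\sum_j lb(a_j)$, and similarly for $ls,rb,rs$. For a partition $\pi$, $lb(\pi)=lb(w(\pi))$,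 etc. $$F_{n,k}(\omega)=F_{n,k}(\omega;q,r,s,t)=\sum_{\pi\in\Pi_{n,k}(\omega)}q^{lb(\pi)}r^{ls(\pi)}s^{rb(\pi)}t^{rs(\pi)}.$$ *)

theory Defs
  imports Main "HOL-Library.Disjoint_Sets"
begin

definition restrict_partition :: "nat set set \<Rightarrow> nat set \<Rightarrow> nat set set" where
  "restrict_partition P S = {B \<inter> S |B. B \<in> P \<and> B \<inter> S \<noteq> {}}"

text \<open>The rank of \<open>x \<in> S\<close> counts \<open>x\<close> itself, so the smallest element of \<open>S\<close> is sent to 1.\<close>

definition rank_in :: "nat set \<Rightarrow> nat \<Rightarrow> nat" where
  "rank_in S x = card {y \<in> S. y \<le> x}"

definition standardize :: "nat set \<Rightarrow> nat set set \<Rightarrow> nat set set" where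
  "standardize S P = (\<lambda>B. rank_in S ` B) ` P"

definition contains_partition :: "nat set set \<Rightarrow> nat set set \<Rightarrow> bool" where
  "contains_partition P Q \<longleftrightarrow> (\<exists>S \<subseteq> \<Union>P. standardize S (restrict_partition P S) = Q)"

definition avoiding_partitions :: "nat \<Rightarrow> nat \<Rightarrow> nat set set \<Rightarrow> nat set set set" where
  "avoiding_partitions n k Q =
     {P. partition_on {1..n} P \<and> card P = k \<and> \<not> contains_partition P Q}"

definition block_list :: "nat set set \<Rightarrow> nat set list" where
  "block_list P = (THE Bs. set Bs = P \<and> sorted_wrt (\<lambda>B C. Min B < Min C) Bs)"

text \<open>Letters and elements of the ground set are numbered from 1, list positions from 0:
  the block \<open>B\<^sub>j\<close> is \<open>block_list P ! (j - 1)\<close>.\<close>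

definition rgf :: "nat \<Rightarrow> nat set set \<Rightarrow> nat list" where
  "rgf n P =
     map (\<lambda>i. THE j. j \<in> {1..length (block_list P)} \<and> i \<in> block_list P ! (j - 1)) [1..<Suc n]"

text \<open>The statistics count distinct values, hence the cardinalities of sets of letters
  rather than of positions.\<close>

definition lb :: "nat list \<Rightarrow> nat" where
  "lb w = (\<Sum>j<length w. card {w ! i |i. i < j \<and> w ! i > w ! j})"

definition ls :: "nat list \<Rightarrow> nat" where
  "ls w = (\<Sum>j<length w. card {w ! i |i. i < j \<and> w ! i < w ! j})"

definition rb :: "nat list \<Rightarrow> nat" where
  "rb w = (\<Sum>j<length w. card {w ! i |i. j < i \<and> i < length w \<and> w ! i > w ! j})"

definition rs :: "nat list \<Rightarrow> nat" where
  "rs w = (\<Sum>j<length w. card {w ! i |i. j < i \<and> i < length w \<and> w ! i < w ! j})"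

text \<open>The generating function is evaluated at elements of an arbitrary commutative semiring.
  An identity for all such elements is the same as an identity of polynomials in four
  indeterminates, since polynomial semirings are instances.\<close>

definition F ::
  "nat \<Rightarrow> nat \<Rightarrow> nat set set \<Rightarrow> 'a::comm_semiring_1 \<Rightarrow> 'a \<Rightarrow> 'a \<Rightarrow> 'a \<Rightarrow> 'a" where
  "F n k Q q r s t =
     (\<Sum>P\<in>avoiding_partitions n k Q.
        q ^ lb (rgf n P) * r ^ ls (rgf n P) * s ^ rb (rgf n P) * t ^ rs (rgf n P))"

end

theory Submission
  imports Defs
begin

text \<open>
  If \<open>b\<close> is the least element sharing its block with some \<open>a < b\<close>, then avoiding \<open>12/3\<close> forces
  every element above \<open>b\<close> into that block, while minimality puts the elements below \<open>b\<close> into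
  distinct blocks. So the restricted growth functions that occur are exactly the words
  \<open>1 2 \<dots> k i i \<dots> i\<close>, on which the four statistics can be read off.
\<close>

section \<open>Occurrences of 12/3, and one partition inside another\<close>

lemma rank_in_mono: "x \<le> y \<Longrightarrow> rank_in S x \<le> rank_in S y"
  unfolding rank_in_def by (rule card_mono) (auto intro: finite_subset[of _ "{..y}"])

lemma rank_in_less_imp_less: "rank_in S x < rank_in S y \<Longrightarrow> x < y"
  using rank_in_mono[of y x S] by linarith

text \<open>An inequality between ranks passes to the elements, so elements of ranks 1, 2, 3 in
  \<open>S\<close> form the pattern. Conversely \<open>S = {a, b, c}\<close> is a witness: by
  disjointness only two blocks of \<open>P\<close> meet it, with traces \<open>{a, b}\<close> and
  \<open>{c}\<close>.\<close>

lemma contains_12_3_iff: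
  assumes "disjoint P"
  shows "contains_partition P {{1, 2}, {3}} \<longleftrightarrow>
    (\<exists>a b c B. a < b \<and> b < c \<and> B \<in> P \<and> a \<in> B \<and> b \<in> B \<and> c \<in> \<Union>P - B)"
    (is "_ \<longleftrightarrow> ?pattern")
proof
  assume "contains_partition P {{1, 2}, {3}}"
  then obtain S where std: "(\<lambda>B. rank_in S ` B) ` restrict_partition P S = {{1, 2}, {3}}"
    unfolding contains_partition_def standardize_def by blast
  from std have "{1, 2} \<in> (\<lambda>B. rank_in S ` B) ` restrict_partition P S"
    and "{3} \<in> (\<lambda>B. rank_in S ` B) ` restrict_partition P S" by blast+
  then obtain B C where B: "B \<in> P" "rank_in S ` (B \<inter> S) = {1, 2}"
    and C: "C \<in> P" "rank_in S ` (C \<inter> S) = {3}"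
    unfolding restrict_partition_def by (smt (verit) imageE mem_Collect_eq)
  have ranks: "1 \<in> rank_in S ` (B \<inter> S)" "2 \<in> rank_in S ` (B \<inter> S)" "3 \<in> rank_in S ` (C \<inter> S)"
    using B(2) C(2) by auto
  from ranks(1) obtain a where a: "a \<in> B" "rank_in S a = 1" by auto
  from ranks(2) obtain b where b: "b \<in> B" "rank_in S b = 2" by auto
  from ranks(3) obtain c where c: "c \<in> C" "c \<in> S" "rank_in S c = 3" by auto
  have "a < b" "b < c" by (rule rank_in_less_imp_less[of S]; simp add: a b c)+
  moreover have "c \<notin> B"
  proof
    assume "c \<in> B"
    then have "rank_in S c \<in> {1, 2}" using B(2) c(2) by blast
    then show False using c(3) by simp
  qed
  ultimately show ?pattern using B(1) C(1) a(1) b(1) c(1) by blast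
next
  assume ?pattern
  then obtain a b c B where abc: "a < b" "b < c" and B: "B \<in> P" "a \<in> B" "b \<in> B" and "c \<in> \<Union>P - B"
    by blast
  then obtain C where C: "C \<in> P" "c \<in> C" "c \<notin> B" by blast
  with B assms have disj: "B \<inter> C = {}" unfolding disjoint_def by blast
  define S where "S = {a, b, c}"
  have BS: "B \<inter> S = {a, b}" and CS: "C \<inter> S = {c}"
    using B C disj unfolding S_def by auto
  have others: "D \<inter> S = {}" if "D \<in> P" "D \<noteq> B" "D \<noteq> C" for D
    using assms that B C unfolding disjoint_def S_def by blast
  have restr: "restrict_partition P S = {{a, b}, {c}}"
  proof (intro equalityI subsetI)
    fix X assume "X \<in> restrict_partition P S"
    then show "X \<in> {{a, b}, {c}}"
      using BS CS others unfolding restrict_partition_def by blast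
  next
    fix X assume "X \<in> {{a, b}, {c}}"
    then show "X \<in> restrict_partition P S"
      using BS CS B(1) C(1) unfolding restrict_partition_def by blast
  qed
  have "{y \<in> S. y \<le> a} = {a}" "{y \<in> S. y \<le> b} = {a, b}" "{y \<in> S. y \<le> c} = {a, b, c}"
    using abc unfolding S_def by auto
  then have "rank_in S a = 1" "rank_in S b = 2" "rank_in S c = 3"
    using abc unfolding rank_in_def by simp_all
  then have "standardize S (restrict_partition P S) = {{1, 2}, {3}}"
    unfolding restr standardize_def by simp
  moreover have "S \<subseteq> \<Union>P" using B C unfolding S_def by blast
  ultimately show "contains_partition P {{1, 2}, {3}}"
    unfolding contains_partition_def by blast
qed

text \<open>An element of a block of \<open>P\<close> also lies in a block of \<open>Q\<close>; both
  are blocks of \<open>P\<close>, hence equal. To identify \<open>P\<close> it therefore suffices to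
  find all blocks of a candidate partition among its own.\<close>

lemma partition_on_subset_eq:
  assumes "partition_on A P" "partition_on A Q" "Q \<subseteq> P"
  shows "Q = P"
proof
  show "P \<subseteq> Q"
  proof
    fix B assume B: "B \<in> P"
    then obtain x where x: "x \<in> B" using partition_onD3[OF assms(1)] by (metis ex_in_conv)
    then have "x \<in> \<Union>Q"
      using B partition_onD1[OF assms(1)] partition_onD1[OF assms(2)] by (metis UnionI)
    then obtain C where C: "C \<in> Q" "x \<in> C" by blast
    then have "C = B"
      using B x assms(3) partition_onD2[OF assms(1)] unfolding disjoint_def by blast
    then show "B \<in> Q" using C(1) by simp
  qed
qed (fact assms(3))

section \<open>The avoiding partitions\<close>

definition tail_block :: "nat \<Rightarrow> nat \<Rightarrow> nat \<Rightarrow> nat \<Rightarrow> nat set" where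
  "tail_block n k i j = (if j = i then insert i {Suc k..n} else {j})"

text \<open>This is the partition with restricted growth function \<open>1 2 ... k i ... i\<close>.
  For \<open>k = n\<close> the tail is empty, and every \<open>i\<close> in \<open>{1..k}\<close>
  gives the partition into singletons.\<close>

definition tail_partition :: "nat \<Rightarrow> nat \<Rightarrow> nat \<Rightarrow> nat set set" where
  "tail_partition n k i = tail_block n k i ` {1..k}"

lemma inj_on_tail_block: "inj_on (tail_block n k i) {1..k}"
  unfolding inj_on_def tail_block_def by auto

lemma partition_on_tail_partition:
  assumes "i \<in> {1..k}" "k \<le> n"
  shows "partition_on {1..n} (tail_partition n k i)"
proof (rule partition_onI)
  show "\<Union>(tail_partition n k i) = {1..n}"
    using assms unfolding tail_partition_def tail_block_def by (auto split: if_splits)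
  show "disjnt p p'" if "p \<in> tail_partition n k i" "p' \<in> tail_partition n k i" "p \<noteq> p'" for p p'
    using that assms unfolding tail_partition_def tail_block_def disjnt_def
    by (auto split: if_splits)
  show "{} \<notin> tail_partition n k i"
    unfolding tail_partition_def tail_block_def by (auto split: if_splits)
qed

lemma card_tail_partition: "card (tail_partition n k i) = k"
  unfolding tail_partition_def using card_image[OF inj_on_tail_block] by simp

lemma tail_partition_avoids:
  assumes "i \<in> {1..k}" "k \<le> n"
  shows "\<not> contains_partition (tail_partition n k i) {{1, 2}, {3}}"
proof
  note part = partition_on_tail_partition[OF assms]
  assume "contains_partition (tail_partition n k i) {{1, 2}, {3}}"
  then obtain a b c B where *: "a < b" "b < c" "B \<in> tail_partition n k i" "a \<in> B" "b \<in> B"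
      "c \<in> {1..n}" "c \<notin> B"
    unfolding contains_12_3_iff[OF partition_onD2[OF part]] partition_onD1[OF part, symmetric]
    by blast
  \<comment> \<open>Only this block can hold two elements. The larger of them, \<open>b\<close>,
    exceeds \<open>k\<close>, so \<open>c > b\<close> would belong to the block too.\<close>
  then have "B = insert i {Suc k..n}"
    unfolding tail_partition_def tail_block_def by (auto split: if_splits)
  with * assms show False by auto
qed

lemma avoiding_partition_is_tail:
  assumes part: "partition_on {1..n} P" and avoid: "\<not> contains_partition P {{1, 2}, {3}}"
    and "1 \<le> card P"
  shows "\<exists>i \<in> {1..card P}. P = tail_partition n (card P) i"
proof -
  note disj = partition_onD2[OF part] and cover = partition_onD1[OF part]
  have same: "B = C" if "B \<in> P" "C \<in> P" "x \<in> B" "x \<in> C" for B C x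
    using disj that unfolding disjoint_def by blast
  \<comment> \<open>Inclusion of the blocks is enough, and the number of blocks need not be known
    beforehand: equality forces \<open>k = card P\<close>.\<close>
  have *: ?thesis if "i \<in> {1..k}" "k \<le> n" "tail_partition n k i \<subseteq> P" for i k
  proof -
    have "P = tail_partition n k i"
      using partition_on_subset_eq[OF part partition_on_tail_partition[OF that(1,2)] that(3)] ..
    with that(1) show ?thesis by (auto simp only: card_tail_partition)
  qed
  \<comment> \<open>The linked elements are those that are not the minimum of their block.\<close>
  define linked where "linked b \<longleftrightarrow> (\<exists>a B. a < b \<and> B \<in> P \<and> a \<in> B \<and> b \<in> B)" for b
  have singleton: "{x} \<in> P" if "x \<in> {1..n}" "\<And>B y. B \<in> P \<Longrightarrow> x \<in> B \<Longrightarrow> y \<in> B \<Longrightarrow> y = x" for x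
  proof -
    have "x \<in> \<Union>P" using that(1) unfolding cover .
    then obtain B where B: "B \<in> P" "x \<in> B" by blast
    have "B \<subseteq> {x}" using that(2)[OF B] by blast
    with B have "B = {x}" by blast
    with B(1) show ?thesis by simp
  qed
  show ?thesis
  proof (cases "\<exists>b. linked b")
    case False
    then have "{x} \<in> P" if "x \<in> {1..n}" for x
      using that singleton unfolding linked_def by (metis nat_neq_iff)
    \<comment> \<open>All blocks are singletons here, which is the case \<open>k = n\<close> with an
      empty tail; the index 1 is an arbitrary choice.\<close>
    then have "tail_partition n n 1 \<subseteq> P"
      unfolding tail_partition_def tail_block_def by auto
    moreover have "1 \<le> n"
    proof (rule ccontr)
      assume "\<not> 1 \<le> n"
      then have "\<Union>P = {}" unfolding cover[symmetric] by simp
      then have "P = {}" using partition_onD3[OF part] by (metis Union_empty_conv equals0I)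
      then show False using assms(3) by simp
    qed
    ultimately show ?thesis using *[of 1 n] by simp
  next
    case True
    define b where "b = (LEAST b. linked b)"
    have "linked b" unfolding b_def using True by (rule LeastI_ex)
    then obtain a B where ab: "a < b" and B: "B \<in> P" "a \<in> B" "b \<in> B"
      unfolding linked_def by blast
    have least: "\<not> linked c" if "c < b" for c using that not_less_Least unfolding b_def by blast
    have "B \<subseteq> {1..n}" unfolding cover using B(1) by blast
    with B have a1: "1 \<le> a" and bn: "b \<le> n" by auto
    \<comment> \<open>A \<open>c\<close> above \<open>b\<close> outside \<open>B\<close> would
      complete \<open>a < b\<close> to an occurrence of 12/3.\<close>
    have above: "c \<in> B" if "b \<le> c" "c \<le> n" for c
    proof (rule ccontr)
      assume "c \<notin> B"
      moreover from this have "b < c" using that(1) B(3) by (cases "c = b") auto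
      moreover have "c \<in> \<Union>P" unfolding cover[symmetric] using that ab by simp
      ultimately have "contains_partition P {{1, 2}, {3}}"
        unfolding contains_12_3_iff[OF disj] using ab B by blast
      with avoid show False by contradiction
    qed
    \<comment> \<open>Of two distinct elements of one block the larger is linked, so by minimality
      of \<open>b\<close> it cannot lie below \<open>b\<close>.\<close>
    have below: "x = y" if "C \<in> P" "x \<in> C" "y \<in> C" "x < b" "y < b" for C x y
      using least that unfolding linked_def by (metis nat_neq_iff)
    have blockB: "B = insert a {b..n}"
    proof (intro equalityI subsetI)
      fix x assume "x \<in> B"
      then show "x \<in> insert a {b..n}"
        using below[OF B(1) B(2), of x] ab \<open>B \<subseteq> {1..n}\<close> by (cases "x < b") auto
    next
      fix x assume "x \<in> insert a {b..n}"
      then show "x \<in> B" using above B(2) by auto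
    qed
    have single: "{x} \<in> P" if "1 \<le> x" "x < b" "x \<noteq> a" for x
    proof (rule singleton)
      show "x \<in> {1..n}" using that bn by simp
      fix C y assume C: "C \<in> P" "x \<in> C" "y \<in> C"
      have "C \<noteq> B" using C that blockB by auto
      then have "y \<notin> B" using same[OF C(1) B(1) C(3)] by blast
      moreover have "y \<in> {1..n}" unfolding cover using C by blast
      ultimately have "y < b" using blockB by auto
      then show "y = x" using below C that by blast
    qed
    \<comment> \<open>The elements \<open>1, ..., b - 1\<close> lie in distinct blocks and the tail
      starts at \<open>b\<close>, whence \<open>k = b - 1\<close>; the tail joins the block of
      \<open>a\<close>.\<close>
    have "tail_partition n (b - 1) a \<subseteq> P"
    proof
      fix C assume "C \<in> tail_partition n (b - 1) a"
      then obtain j where "1 \<le> j" "j < b" "C = tail_block n (b - 1) a j"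
        using ab unfolding tail_partition_def by fastforce
      then show "C \<in> P"
        using single[of j] B(1) blockB ab unfolding tail_block_def by (cases "j = a") auto
    qed
    moreover have "a \<in> {1..b - 1}" "b - 1 \<le> n" using ab a1 bn by auto
    ultimately show ?thesis using * by blast
  qed
qed

lemma avoiding_partitions_12_3:
  assumes "1 \<le> k" "k \<le> n"
  shows "avoiding_partitions n k {{1, 2}, {3}} = tail_partition n k ` {1..k}"
proof (intro equalityI subsetI)
  fix P assume "P \<in> avoiding_partitions n k {{1, 2}, {3}}"
  then show "P \<in> tail_partition n k ` {1..k}"
    using avoiding_partition_is_tail[of n P] assms(1) unfolding avoiding_partitions_def by blast
next
  fix P assume "P \<in> tail_partition n k ` {1..k}"
  then show "P \<in> avoiding_partitions n k {{1, 2}, {3}}"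
    using partition_on_tail_partition tail_partition_avoids card_tail_partition assms(2)
    unfolding avoiding_partitions_def by blast
qed

section \<open>Restricted growth functions of the avoiding partitions\<close>

lemma block_list_eqI:
  assumes "set Bs = P" "sorted_wrt (\<lambda>B C. Min B < Min C) Bs"
  shows "block_list P = Bs"
  unfolding block_list_def
proof (rule the_equality)
  fix Cs assume Cs: "set Cs = P \<and> sorted_wrt (\<lambda>B C. Min B < Min C) Cs"
  have sorted: "sorted_wrt (<) (map Min Cs)" "sorted_wrt (<) (map Min Bs)"
    using Cs assms(2) by (simp_all add: sorted_wrt_map)
  then have "map Min Cs = map Min Bs"
    using strict_sorted_equal Cs assms(1) by (metis set_map)
  \<comment> \<open>Since the minima increase strictly, \<open>Min\<close> is injective on the
    blocks, and the list of minima determines the list of blocks.\<close>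
  moreover have "inj_on Min (set Cs \<union> set Bs)"
    using sorted(2) Cs assms(1) by (metis Un_absorb distinct_map strict_sorted_iff)
  ultimately show "Cs = Bs" using inj_on_map_eq_map by blast
qed (use assms in simp)

lemma block_list_tail_partition:
  assumes "i \<in> {1..k}"
  shows "block_list (tail_partition n k i) = map (tail_block n k i) [1..<Suc k]"
proof (rule block_list_eqI)
  show "set (map (tail_block n k i) [1..<Suc k]) = tail_partition n k i"
    unfolding tail_partition_def by (simp add: atLeastLessThanSuc_atLeastAtMost del: upt_Suc)
  have "Min (tail_block n k i j) = j" for j
    using assms unfolding tail_block_def by (auto intro!: Min_eqI)
  then show "sorted_wrt (\<lambda>B C. Min B < Min C) (map (tail_block n k i) [1..<Suc k])"
    by (simp add: sorted_wrt_map del: upt_Suc)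
qed

definition tail_word :: "nat \<Rightarrow> nat \<Rightarrow> nat \<Rightarrow> nat list" where
  "tail_word k m i = [1..<Suc k] @ replicate m i"

lemma rgf_tail_partition:
  assumes "i \<in> {1..k}" "k \<le> n"
  shows "rgf n (tail_partition n k i) = tail_word k (n - k) i"
proof -
  \<comment> \<open>An element \<open>x\<close> up to \<open>k\<close> lies in block number
    \<open>x\<close>, at list position \<open>x - 1\<close>; every later element lies in block
    \<open>i\<close>.\<close>
  have letter: "(THE j. j \<in> {1..length (block_list (tail_partition n k i))} \<and>
      x \<in> block_list (tail_partition n k i) ! (j - 1)) = (if x \<le> k then x else i)"
    if "x \<in> {1..n}" for x
    unfolding block_list_tail_partition[OF assms(1)] using assms that
    by (intro the_equality) (auto simp: tail_block_def nth_append simp del: upt_Suc split: if_splits)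
  have split: "[1..<Suc n] = [1..<Suc k] @ [Suc k..<Suc n]"
    using upt_add_eq_append[of 1 "Suc k" "n - k"] assms by simp
  have "rgf n (tail_partition n k i) = map (\<lambda>x. if x \<le> k then x else i) [1..<Suc n]"
    unfolding rgf_def using letter by (intro map_cong) auto
  also have "\<dots> = map (\<lambda>x. x) [1..<Suc k] @ map (\<lambda>x. i) [Suc k..<Suc n]"
    unfolding split map_append by (intro arg_cong2[where f = append] map_cong) auto
  also have "\<dots> = tail_word k (n - k) i"
    unfolding tail_word_def by (simp add: map_replicate_const del: upt_Suc)
  finally show ?thesis .
qed

section \<open>The four statistics on the words \<open>1 2 ... k i ... i\<close>\<close>

lemma length_tail_word: "length (tail_word k m i) = k + m"
  by (simp add: tail_word_def)

lemma nth_tail_word: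
  "j < k + m \<Longrightarrow> tail_word k m i ! j = (if j < k then Suc j else i)"
  unfolding tail_word_def by (auto simp: nth_append simp del: upt_Suc)

text \<open>Separates the increasing run from the tail, all of whose positions contribute equally to
  a statistic.\<close>

lemma sum_lessThan_const_tail:
  fixes f :: "nat \<Rightarrow> nat"
  assumes "\<And>j. j < k \<Longrightarrow> f j = g j" and "\<And>j. k \<le> j \<Longrightarrow> j < k + m \<Longrightarrow> f j = c"
  shows "(\<Sum>j<k + m. f j) = (\<Sum>j<k. g j) + m * c"
proof -
  have "{..<k + m} = {..<k} \<union> {k..<k + m}" by auto
  then have "(\<Sum>j<k + m. f j) = (\<Sum>j<k. f j) + (\<Sum>j\<in>{k..<k + m}. f j)"
    by (simp add: sum.union_disjoint ivl_disj_int)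
  then show ?thesis using assms by simp
qed

lemma sum_lessThan_choose_two: "(\<Sum>j<k. j) = k choose 2"
  by (induction k) (auto simp: numeral_2_eq_2)

text \<open>The increasing run contributes nothing, while each of the \<open>m\<close> tail letters
  has exactly the values \<open>i + 1, ..., k\<close> as larger ones to its left.\<close>

lemma lb_tail_word:
  assumes "i \<in> {1..k}"
  shows "lb (tail_word k m i) = m * (k - i)"
proof -
  let ?w = "tail_word k m i"
  have "{?w ! h |h. h < j \<and> ?w ! h > ?w ! j} = {}" if "j < k" for j
    using that by (auto simp: nth_tail_word)
  moreover have "{?w ! h |h. h < j \<and> ?w ! h > ?w ! j} = {i<..k}" if "k \<le> j" "j < k + m" for j
  proof (intro equalityI subsetI)
    fix x assume "x \<in> {i<..k}"
    \<comment> \<open>Positions count from 0, so the letter \<open>x\<close> of the run stands at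
      position \<open>x - 1\<close>.\<close>
    with that show "x \<in> {?w ! h |h. h < j \<and> ?w ! h > ?w ! j}"
      by (auto simp: nth_tail_word intro!: exI[of _ "x - 1"])
  qed (use that in \<open>auto simp: nth_tail_word split: if_splits\<close>)
  ultimately have "lb ?w = (\<Sum>j<k. 0) + m * (k - i)"
    unfolding lb_def length_tail_word by (intro sum_lessThan_const_tail) simp_all
  then show ?thesis by simp
qed

lemma ls_tail_word:
  assumes "i \<in> {1..k}"
  shows "ls (tail_word k m i) = (k choose 2) + m * (i - 1)"
proof -
  let ?w = "tail_word k m i"
  have "{?w ! h |h. h < j \<and> ?w ! h < ?w ! j} = {1..j}" if "j < k" for j
  proof (intro equalityI subsetI)
    fix x assume "x \<in> {1..j}"
    with that show "x \<in> {?w ! h |h. h < j \<and> ?w ! h < ?w ! j}"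
      by (auto simp: nth_tail_word intro!: exI[of _ "x - 1"])
  qed (use that in \<open>auto simp: nth_tail_word\<close>)
  moreover have "{?w ! h |h. h < j \<and> ?w ! h < ?w ! j} = {1..<i}" if "k \<le> j" "j < k + m" for j
  proof (intro equalityI subsetI)
    fix x assume "x \<in> {1..<i}"
    with that assms show "x \<in> {?w ! h |h. h < j \<and> ?w ! h < ?w ! j}"
      by (auto simp: nth_tail_word intro!: exI[of _ "x - 1"])
  qed (use that in \<open>auto simp: nth_tail_word split: if_splits\<close>)
  ultimately have "ls ?w = (\<Sum>j<k. j) + m * (i - 1)"
    unfolding ls_def length_tail_word by (intro sum_lessThan_const_tail) simp_all
  then show ?thesis by (simp add: sum_lessThan_choose_two)
qed

text \<open>The tail adds nothing: if \<open>i\<close> exceeds a letter of the run, then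
  \<open>i\<close> already occurs to the right of that letter within the run, and values are counted
  once.\<close>

lemma rb_tail_word:
  assumes "i \<in> {1..k}"
  shows "rb (tail_word k m i) = k choose 2"
proof -
  let ?w = "tail_word k m i"
  have "{?w ! h |h. j < h \<and> h < k + m \<and> ?w ! h > ?w ! j} = {Suc j<..k}" if "j < k" for j
  proof (intro equalityI subsetI)
    fix x assume "x \<in> {Suc j<..k}"
    with that show "x \<in> {?w ! h |h. j < h \<and> h < k + m \<and> ?w ! h > ?w ! j}"
      by (auto simp: nth_tail_word intro!: exI[of _ "x - 1"])
  qed (use that assms in \<open>auto simp: nth_tail_word split: if_splits\<close>)
  moreover have "{?w ! h |h. j < h \<and> h < k + m \<and> ?w ! h > ?w ! j} = {}"
    if "k \<le> j" "j < k + m" for j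
    using that by (auto simp: nth_tail_word)
  ultimately have "rb ?w = (\<Sum>j<k. k - Suc j) + m * 0"
    unfolding rb_def length_tail_word by (intro sum_lessThan_const_tail) simp_all
  \<comment> \<open>Reversing the order of summation turns the terms \<open>k - Suc j\<close> into
    \<open>j\<close>.\<close>
  also have "\<dots> = k choose 2"
    by (simp add: sum.nat_diff_reindex[of "\<lambda>j. j"] sum_lessThan_choose_two)
  finally show ?thesis .
qed

text \<open>The only value that can be smaller and further right is \<open>i\<close>, seen from the
  letters \<open>i + 1, ..., k\<close> of the run. It counts once however long the tail is, provided
  that the tail is nonempty.\<close>

lemma rs_tail_word:
  assumes "i \<in> {1..k}"
  shows "rs (tail_word k m i) = (if m = 0 then 0 else k - i)"
proof -
  let ?w = "tail_word k m i"
  have "{?w ! h |h. j < h \<and> h < k + m \<and> ?w ! h < ?w ! j} = (if m > 0 \<and> i \<le> j then {i} else {})"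
    if "j < k" for j
  proof (cases "m > 0 \<and> i \<le> j")
    case True
    with that have "i \<in> {?w ! h |h. j < h \<and> h < k + m \<and> ?w ! h < ?w ! j}"
      by (auto simp: nth_tail_word intro!: exI[of _ k])
    with True that show ?thesis by (auto simp: nth_tail_word split: if_splits)
  qed (use that in \<open>auto simp: nth_tail_word split: if_splits\<close>)
  moreover have "{?w ! h |h. j < h \<and> h < k + m \<and> ?w ! h < ?w ! j} = {}"
    if "k \<le> j" "j < k + m" for j
    using that by (auto simp: nth_tail_word)
  ultimately have "rs ?w = (\<Sum>j<k. if m > 0 \<and> i \<le> j then 1 else 0) + m * 0"
    unfolding rs_def length_tail_word by (intro sum_lessThan_const_tail) simp_all
  also have "\<dots> = card {j \<in> {..<k}. m > 0 \<and> i \<le> j}"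
    by (subst card_eq_sum, subst sum.inter_filter) simp_all
  also have "{j \<in> {..<k}. m > 0 \<and> i \<le> j} = (if m = 0 then {} else {i..<k})" by auto
  finally show ?thesis by simp
qed

section \<open>Summation over the avoiding partitions\<close>

lemma inj_on_tail_partition:
  assumes "k < n"
  shows "inj_on (tail_partition n k) {1..k}"
proof (rule inj_onI)
  fix i j assume ij: "i \<in> {1..k}" "j \<in> {1..k}" "tail_partition n k i = tail_partition n k j"
  \<comment> \<open>The word reveals \<open>i\<close>, because \<open>n - k > 0\<close> leaves at
    least one letter in the tail.\<close>
  then have "tail_word k (n - k) i = tail_word k (n - k) j"
    using assms by (metis less_imp_le rgf_tail_partition)
  then show "i = j" using assms unfolding tail_word_def by simp
qed

theorem theorem5p1:
  fixes n k :: nat and q r s t :: "'a::comm_semiring_1"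
  assumes "1 \<le> k" and "k \<le> n"
  shows "(n = k \<longrightarrow> F n k {{1, 2}, {3}} q r s t = (r * s) ^ (k choose 2)) \<and>
         (n > k \<longrightarrow> F n k {{1, 2}, {3}} q r s t =
            (\<Sum>i=1..k. q ^ ((n - k) * (k - i)) * r ^ ((k choose 2) + (n - k) * (i - 1)) *
                       s ^ (k choose 2) * t ^ (k - i)))"
proof (intro conjI impI)
  note avoid = avoiding_partitions_12_3[OF assms]
  note stats = rgf_tail_partition lb_tail_word ls_tail_word rb_tail_word rs_tail_word
  {
    assume "n = k"
    \<comment> \<open>With an empty tail all indices give the same partition, so the sum has a
      single term.\<close>
    then have "tail_partition n k i = tail_partition n k k" for i
      unfolding tail_partition_def tail_block_def by (intro image_cong) auto
    then have "tail_partition n k ` {1..k} = {tail_partition n k k}"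
      using assms(1) by auto
    then show "F n k {{1, 2}, {3}} q r s t = (r * s) ^ (k choose 2)"
      using assms \<open>n = k\<close> unfolding F_def avoid by (simp add: stats power_mult_distrib)
  next
    assume "n > k"
    then show "F n k {{1, 2}, {3}} q r s t =
        (\<Sum>i=1..k. q ^ ((n - k) * (k - i)) * r ^ ((k choose 2) + (n - k) * (i - 1)) *
                   s ^ (k choose 2) * t ^ (k - i))"
      \<comment> \<open>By injectivity each partition corresponds to one index \<open>i\<close>, and
        the statistics give its monomial.\<close>
      unfolding F_def avoid sum.reindex[OF inj_on_tail_partition[OF \<open>n > k\<close>]]
      by (intro sum.cong) (simp_all add: stats assms(2))
  }
qed

end
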